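(* Let $T$ be a totally minimal tree. Then the following trees are totally minimal: (i) the path $P_{p-1}$ on $p-1$ vertices, for every prime $p$; (ii) the rooted product $T\circ P_2$; (iii) the rooted product $T\circ P_4$, where the root of $P_4$ is a vertex of degree $2$.
   Context: A tree $T$ is totally minimal if for every eigenvalue $\lambda$ of its adjacency matrix $A_T$, $A_T$ has a $\lambda$-eigenvector all of whose coordinates are nonzero. For a graph $G$ with vertices $u_1,\dots,u_n$ and a rooted graph $H$ with root $v_1$, the rooted product $G\circ H$ is obtained from $G$ and $n$ copies $H_1,\dots,H_n$ of $H$ by identifying the root of $H_i$ with $u_i$ for each $i$. $P_k$ denotes the path on $k$ vertices (in $P_2$ the root is either vertex). *)

theory Defs
  imports
    "Graph_Theory.Digraph_Component"
    "Jordan_Normal_Form.Char_Poly"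
    "HOL-Computational_Algebra.Primes"
begin

text \<open>
  A finite simple graph is a \<^locale>\<open>pair_graph\<close>: finitely many vertices, and every edge is
  represented by two opposite arcs.  Hence going back and forth along one edge is a directed cycle
  of length 2, so the constant \<^const>\<open>tree\<close> of the library fails as soon as there is an edge.
  The cycles of the undirected graph are exactly the directed cycles of length at least 3.
\<close>

definition undirected_tree :: "'a pair_pre_digraph \<Rightarrow> bool" where
  "undirected_tree G \<longleftrightarrow>
     pair_graph G \<and> Digraph_Component.connected (with_proj G) \<and>
     \<not> (\<exists>p. pre_digraph.cycle (with_proj G) p \<and> length p \<ge> 3)"

definition adjacency_matrix :: "'a pair_pre_digraph \<Rightarrow> 'a list \<Rightarrow> real mat" where
  "adjacency_matrix G vs =
     mat (length vs) (length vs) (\<lambda>(i, j). if (vs ! i, vs ! j) \<in> parcs G then 1 else 0)"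

text \<open>
  The adjacency matrix depends on an ordering of the vertices, but only up to simultaneous
  permutation of rows and columns, so the property below is the same for every ordering.  Since
  the matrix is real symmetric, all its eigenvalues are real.
\<close>

definition totally_minimal :: "'a pair_pre_digraph \<Rightarrow> bool" where
  "totally_minimal T \<longleftrightarrow>
     undirected_tree T \<and>
     (\<forall>vs. distinct vs \<and> set vs = pverts T \<longrightarrow>
        (\<forall>l. eigenvalue (adjacency_matrix T vs) l \<longrightarrow>
           (\<exists>x. eigenvector (adjacency_matrix T vs) x l \<and> (\<forall>i < dim_vec x. x $ i \<noteq> 0))))"

definition path_graph :: "nat \<Rightarrow> nat pair_pre_digraph" where
  "path_graph k =
     \<lparr> pverts = {..<k}, parcs = {(i, j). i < k \<and> j < k \<and> (j = Suc i \<or> i = Suc j)} \<rparr>"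

text \<open>
  The vertex \<open>(u, x)\<close> is the vertex \<open>x\<close> of the copy of \<open>H\<close> attached at \<open>u\<close>; in
  particular \<open>(u, r)\<close> is \<open>u\<close> itself, identified with the root of that copy.
\<close>

definition rooted_product ::
    "'a pair_pre_digraph \<Rightarrow> 'b pair_pre_digraph \<Rightarrow> 'b \<Rightarrow> ('a \<times> 'b) pair_pre_digraph" where
  "rooted_product G H r =
     \<lparr> pverts = pverts G \<times> pverts H,
       parcs = {((u, r), (v, r)) | u v. (u, v) \<in> parcs G} \<union>
               {((u, x), (u, y)) | u x y. u \<in> pverts G \<and> (x, y) \<in> parcs H} \<rparr>"

end

theory Submission
  imports Defs
begin

text \<open>
  An eigenvector is a function \<open>f\<close> on the vertices whose sum over the neighbours of \<open>v\<close> is \<open>l * f v\<close>.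
  On a path such functions are multiples of the sequence \<open>U\<^sub>0 = 0\<close>, \<open>U\<^sub>1 = 1\<close>,
  \<open>U\<^sub>j\<^sub>+\<^sub>2 = l U\<^sub>j\<^sub>+\<^sub>1 - U\<^sub>j\<close>, with \<open>U\<^sub>p = 0\<close> for the path on \<open>p - 1\<close> vertices.  If \<open>U\<^sub>k = 0\<close>, then
  \<open>U\<close> restarts at \<open>k\<close> up to the nonzero factor \<open>U\<^sub>k\<^sub>+\<^sub>1\<close>; hence the least positive zero divides \<open>p\<close>
  and no coordinate vanishes when \<open>p\<close> is prime.  In a rooted product with \<open>P\<^sub>2\<close> or \<open>P\<^sub>4\<close> the
  equations off the roots determine an eigenfunction from its values at the roots, by nonzero
  factors, and these values form an eigenfunction of \<open>T\<close>.
\<close>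

section \<open>Trees\<close>

text \<open>A cycle is a sequence over all naturals with exact period \<open>n\<close>, so that
  rotating it is a mere index shift. The bound \<open>3\<close> excludes going back and forth along
  one edge.\<close>

definition circuit :: "'v rel \<Rightarrow> nat \<Rightarrow> (nat \<Rightarrow> 'v) \<Rightarrow> bool" where
  "circuit E n s \<longleftrightarrow> 3 \<le> n \<and> (\<forall>i j. s i = s j \<longleftrightarrow> i mod n = j mod n) \<and> (\<forall>i. (s i, s (Suc i)) \<in> E)"

lemma circuit_shift:
  assumes "circuit E n s"
  shows "circuit E n (\<lambda>i. s (i + k))"
proof -
  have "(i + k) mod n = (j + k) mod n \<longleftrightarrow> i mod n = j mod n" for i j
    unfolding nat_mod_eq_iff by simp
  then show ?thesis
    using assms by (simp add: circuit_def)
qed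

lemma pcas_iff_nth:
  "pcas u p v \<longleftrightarrow>
    (if p = [] then u = v
     else fst (p ! 0) = u \<and> snd (last p) = v \<and> (\<forall>i. Suc i < length p \<longrightarrow> snd (p ! i) = fst (p ! Suc i)))"
proof (induction p arbitrary: u)
  case (Cons e p)
  show ?case
  proof (cases p)
    case (Cons e' p')
    then show ?thesis
      unfolding pcas.simps Cons.IH by (auto simp: nth_Cons split: nat.splits)
  qed auto
qed auto

context pair_wf_digraph
begin

lemma cycle_iff_pcas:
  "cycle p \<longleftrightarrow> set p \<subseteq> parcs G \<and> p \<noteq> [] \<and> (\<exists>u. pcas u p u) \<and> distinct (map snd p)"
proof (cases p)
  case (Cons e q)
  have "tl (pawalk_verts u p) = map snd p" if "pcas u p u" for u
    using awalk_verts_conv'[of u p u] that Cons by simp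
  moreover have "u \<in> pverts G" if "pcas u p u" "set p \<subseteq> parcs G" for u
    using that Cons by (auto dest: arc_fst_in_verts)
  ultimately show ?thesis
    using Cons unfolding cycle_def awalk_def by (metis list.distinct(1))
qed (simp add: cycle_def)

text \<open>From a cycle one reads off the heads of its arcs cyclically; from a circuit one takes
  the arcs of one period.\<close>

lemma ex_cycle_iff_circuit:
  "(\<exists>p. cycle p \<and> length p \<ge> 3) \<longleftrightarrow> (\<exists>n s. circuit (parcs G) n s)"
proof
  assume "\<exists>p. cycle p \<and> length p \<ge> 3"
  then obtain p u where p: "set p \<subseteq> parcs G" "pcas u p u" "distinct (map snd p)" "length p \<ge> 3"
    by (auto simp: cycle_iff_pcas)
  define n where "n = length p"
  define s where "s i = snd (p ! (i mod n))" for i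
  have n: "n \<ge> 3" and "p \<noteq> []"
    using p(4) by (auto simp: n_def)
  have lt: "i mod n < n" for i
    using n by simp
  have "s i = s j \<longleftrightarrow> i mod n = j mod n" for i j
    using nth_eq_iff_index_eq[OF p(3), of "i mod n" "j mod n"] lt[of i] lt[of j]
    by (simp add: s_def n_def)
  moreover have "fst (p ! (Suc i mod n)) = s i" for i
  \<comment> \<open>At the last arc the join with the first one comes from the walk being closed,
    elsewhere from adjacency in the list.\<close>
  proof (cases "Suc (i mod n) = n")
    case True
    then have "i mod n = n - 1" "Suc i mod n = 0"
      by (auto simp: mod_Suc)
    then show ?thesis
      using p(2) \<open>p \<noteq> []\<close> by (simp add: pcas_iff_nth s_def last_conv_nth n_def)
  next
    case False
    then have "Suc (i mod n) < n" "Suc i mod n = Suc (i mod n)"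
      using lt[of i] by (auto simp: mod_Suc)
    then show ?thesis
      using p(2) \<open>p \<noteq> []\<close> by (auto simp: pcas_iff_nth s_def n_def)
  qed
  moreover have "p ! (Suc i mod n) \<in> parcs G" for i
    using p(1) lt[of "Suc i"] by (auto simp: n_def)
  ultimately have "circuit (parcs G) n s"
    using n by (auto simp: circuit_def) (metis prod.collapse s_def)
  then show "\<exists>n s. circuit (parcs G) n s"
    by blast
next
  assume "\<exists>n s. circuit (parcs G) n s"
  then obtain n s where s: "circuit (parcs G) n s"
    by blast
  define p where "p = map (\<lambda>i. (s i, s (Suc i))) [0..<n]"
  have n: "n \<ge> 3" and per: "s n = s 0"
    using s by (auto simp: circuit_def)
  have inj: "inj_on (\<lambda>i. s (Suc i)) {0..<n}"
    using circuit_shift[OF s, of 1] by (auto simp: circuit_def inj_on_def)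
  have "pcas (s 0) p (s 0)"
    using n per by (auto simp: pcas_iff_nth p_def last_conv_nth)
  moreover have "map snd p = map (\<lambda>i. s (Suc i)) [0..<n]"
    by (simp add: p_def)
  then have "distinct (map snd p)"
    using inj by (simp only: distinct_map) simp
  moreover have "set p \<subseteq> parcs G" "p \<noteq> []"
    using s n by (auto simp: p_def circuit_def)
  ultimately have "cycle p"
    unfolding cycle_iff_pcas by blast
  then show "\<exists>p. cycle p \<and> length p \<ge> 3"
    using n by (auto simp: p_def)
qed

end

section \<open>Trees in terms of the arc relation\<close>

lemma pair_graph_iff:
  "pair_graph G \<longleftrightarrow>
    finite (pverts G) \<and> parcs G \<subseteq> pverts G \<times> pverts G \<and> sym (parcs G) \<and> irrefl (parcs G)"
proof
  assume "pair_graph G"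
  then interpret pair_graph G .
  show "finite (pverts G) \<and> parcs G \<subseteq> pverts G \<times> pverts G \<and> sym (parcs G) \<and> irrefl (parcs G)"
    using pair_finite_verts pair_sym_arcs no_loops'
    by (auto simp: symmetric_def irrefl_def dest: in_arcsD1 in_arcsD2)
next
  assume "finite (pverts G) \<and> parcs G \<subseteq> pverts G \<times> pverts G \<and> sym (parcs G) \<and> irrefl (parcs G)"
  then show "pair_graph G"
    by unfold_locales
      (auto simp: symmetric_def irrefl_def intro: finite_subset[OF _ finite_cartesian_product])
qed

text \<open>The arcs are already symmetric, so symmetrising the graph adds no walks.\<close>

lemma (in pair_graph) connected_iff_rtrancl:
  "Digraph_Component.connected (with_proj G) \<longleftrightarrow>
    pverts G \<noteq> {} \<and> (\<forall>u\<in>pverts G. \<forall>v\<in>pverts G. (u, v) \<in> (parcs G)\<^sup>*)"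
proof -
  have "u \<rightarrow>\<^sup>*\<^bsub>with_proj G\<^esub> v \<longleftrightarrow> (u, v) \<in> (parcs G)\<^sup>*" if "u \<in> pverts G" for u v
    using that by (auto dest: reachable_rtranclI rtranclD)
  then show ?thesis
    using reachable_mk_symmetric_eq[OF sym_arcs]
    by (simp add: Digraph_Component.connected_def strongly_connected_def)
qed

lemma undirected_tree_iff:
  "undirected_tree G \<longleftrightarrow>
    finite (pverts G) \<and> parcs G \<subseteq> pverts G \<times> pverts G \<and> sym (parcs G) \<and> irrefl (parcs G) \<and>
    pverts G \<noteq> {} \<and> (\<forall>u\<in>pverts G. \<forall>v\<in>pverts G. (u, v) \<in> (parcs G)\<^sup>*) \<and>
    (\<forall>n s. \<not> circuit (parcs G) n s)"
proof (cases "pair_graph G")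
  case True
  then interpret pair_graph G .
  show ?thesis
    using True connected_iff_rtrancl ex_cycle_iff_circuit
    unfolding undirected_tree_def pair_graph_iff by auto
next
  case False
  then show ?thesis
    unfolding undirected_tree_def pair_graph_iff by auto
qed

lemma undirected_treeD:
  assumes "undirected_tree G"
  shows "finite (pverts G)" "parcs G \<subseteq> pverts G \<times> pverts G" "sym (parcs G)" "irrefl (parcs G)"
    "pverts G \<noteq> {}" "\<And>u v. u \<in> pverts G \<Longrightarrow> v \<in> pverts G \<Longrightarrow> (u, v) \<in> (parcs G)\<^sup>*"
    "\<And>n s. \<not> circuit (parcs G) n s"
  using assms unfolding undirected_tree_iff by blast+

lemma undirected_tree_neighbours:
  assumes "undirected_tree G"
  shows "finite (parcs G `` {u})" "u \<notin> parcs G `` {u}" "parcs G `` {u} \<subseteq> pverts G"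
proof -
  show sub: "parcs G `` {u} \<subseteq> pverts G"
    using undirected_treeD(2)[OF assms] by blast
  show "finite (parcs G `` {u})"
    using sub undirected_treeD(1)[OF assms] by (rule finite_subset)
  show "u \<notin> parcs G `` {u}"
    using undirected_treeD(4)[OF assms] by (simp add: irrefl_def)
qed

section \<open>Paths are trees\<close>

lemma pverts_path_graph [simp]: "pverts (path_graph n) = {..<n}"
  by (simp add: path_graph_def)

lemma parcs_path_graph_iff [simp]:
  "(i, j) \<in> parcs (path_graph n) \<longleftrightarrow> i < n \<and> j < n \<and> (j = Suc i \<or> i = Suc j)"
  by (simp add: path_graph_def)

text \<open>At the largest vertex of a circuit both circuit neighbours would be its predecessor in
  the path. Then two positions at distance 2 carry the same vertex, against a period of at least
  3.\<close>

lemma not_circuit_path_graph: "\<not> circuit (parcs (path_graph k)) n s"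
proof
  assume c: "circuit (parcs (path_graph k)) n s"
  have "range s \<subseteq> {..<k}"
    using c by (auto simp: circuit_def)
  then have "finite (range s)"
    using finite_subset by blast
  moreover from this have "Max (range s) \<in> range s"
    by (intro Max_in) auto
  ultimately obtain m where m: "\<And>i. s i \<le> s m"
    by (metis Max_ge rangeE rangeI)
  have n: "n \<ge> 3" and arc: "\<And>i. (s i, s (Suc i)) \<in> parcs (path_graph k)"
    and inj: "\<And>i j. s i = s j \<longleftrightarrow> i mod n = j mod n"
    using c by (auto simp: circuit_def)
  \<comment> \<open>The position cyclically before \<open>m\<close>; adding \<open>n\<close> keeps
    the subtraction from truncating when \<open>m = 0\<close>.\<close>
  define i where "i = m + n - 1"
  have "s m = s (Suc i)"
    using n by (simp add: inj i_def)
  then have "s (Suc i) = Suc (s i)" "s (Suc i) = Suc (s (Suc (Suc i)))"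
    using m[of i] m[of "Suc (Suc i)"] arc[of i] arc[of "Suc i"] by auto
  then have "(i + 2) mod n = i mod n"
    by (simp flip: inj)
  then have "n dvd 2"
    by (metis add_diff_cancel_left' le_add1 mod_eq_dvd_iff_nat)
  then show False
    using n by (auto dest: dvd_imp_le)
qed

lemma undirected_tree_path_graph:
  assumes "n > 0"
  shows "undirected_tree (path_graph n)"
proof -
  have sym: "sym (parcs (path_graph n))"
    by (auto simp: sym_def)
  have zero: "(0, i) \<in> (parcs (path_graph n))\<^sup>*" if "i < n" for i
    using that
  proof (induction i)
    case (Suc i)
    then show ?case
      by (auto intro!: rtrancl_into_rtrancl[of 0 i])
  qed simp
  have "(i, j) \<in> (parcs (path_graph n))\<^sup>*" if "i < n" "j < n" for i j
    using zero[OF that(1)] zero[OF that(2)] sym_rtrancl[OF sym] by (meson rtrancl_trans symD)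
  then show ?thesis
    using assms sym not_circuit_path_graph
    by (auto simp: undirected_tree_iff irrefl_def)
qed

section \<open>Rooted products of trees are trees\<close>

lemma pverts_rooted_product [simp]: "pverts (rooted_product G H r) = pverts G \<times> pverts H"
  by (simp add: rooted_product_def)

lemma parcs_rooted_product_iff:
  "(a, b) \<in> parcs (rooted_product G H r) \<longleftrightarrow>
    (fst a, fst b) \<in> parcs G \<and> snd a = r \<and> snd b = r \<or>
    fst a = fst b \<and> fst a \<in> pverts G \<and> (snd a, snd b) \<in> parcs H"
  by (cases a; cases b) (auto simp: rooted_product_def)

text \<open>
  A circuit through a vertex \<open>(u, x)\<close> with \<open>x \<noteq> r\<close> can leave the copy of \<open>H\<close> at \<open>u\<close> only through
  \<open>(u, r)\<close> and has to return through the same vertex, so it stays in that copy.  A circuit through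
  no such vertex lives in \<open>G\<close>.
\<close>

lemma not_circuit_rooted_product:
  assumes G: "\<And>n s. \<not> circuit (parcs G) n s" "irrefl (parcs G)"
    and H: "\<And>n s. \<not> circuit (parcs H) n s" "irrefl (parcs H)"
  shows "\<not> circuit (parcs (rooted_product G H r)) n s"
proof
  let ?E = "parcs (rooted_product G H r)"
  assume c: "circuit ?E n s"
  show False
  proof (cases "\<forall>i. snd (s i) = r")
    case True
    moreover have "(s i, s (Suc i)) \<in> ?E" for i
      using c by (simp add: circuit_def)
    ultimately have "(fst (s i), fst (s (Suc i))) \<in> parcs G" for i
      using H(2) unfolding parcs_rooted_product_iff irrefl_def by metis
    then have "circuit (parcs G) n (fst \<circ> s)"
      using c True by (auto simp: circuit_def prod_eq_iff)
    then show False
      using G by blast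
  next
    case False
    then obtain k where k: "snd (s k) \<noteq> r"
      by blast
    define t where "t i = s (i + k)" for i
    have t: "circuit ?E n t" "snd (t 0) \<noteq> r"
      using circuit_shift[OF c] k unfolding t_def by simp_all
    define u where "u = fst (t 0)"
    have n: "n \<ge> 3" and inj: "\<And>i j. t i = t j \<longleftrightarrow> i mod n = j mod n"
      and arc: "\<And>i. (t i, t (Suc i)) \<in> ?E"
      using t by (auto simp: circuit_def)
    have cross: "t i = (fst (t i), r) \<and> t (Suc i) = (fst (t (Suc i)), r)" if "fst (t i) \<noteq> fst (t (Suc i))" for i
      using arc[of i] that unfolding parcs_rooted_product_iff by (auto simp: prod_eq_iff)
    have per: "t (i mod n) = t i" for i
      by (simp add: inj)
    show False
    proof (cases "\<forall>i. fst (t i) = u")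
      case True
      then have "(snd (t i), snd (t (Suc i))) \<in> parcs H" for i
        using arc[of i] G(2) unfolding parcs_rooted_product_iff irrefl_def by metis
      then have "circuit (parcs H) n (snd \<circ> t)"
        using t(1) True by (auto simp: circuit_def prod_eq_iff)
      then show False
        using H by blast
    next
      case False
      \<comment> \<open>The positions of one period outside the copy at \<open>u\<close>. Just
        before the least and just after the greatest of them the circuit is at
        \<open>(u, r)\<close>.\<close>
      define S where "S = {i. i < n \<and> fst (t i) \<noteq> u}"
      have "S \<noteq> {}"
        using False n per unfolding S_def
        by (metis (mono_tags, lifting) empty_Collect_eq mod_less_divisor not_numeral_le_zero gr0I)
      have "finite S"
        by (simp add: S_def)
      define i where "i = Min S"
      define j where "j = Max S"
      have ij: "i \<in> S" "j \<in> S" "i \<le> j"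
        using \<open>S \<noteq> {}\<close> \<open>finite S\<close> by (auto simp: i_def j_def)
      then have "i \<noteq> 0" "j < n"
        by (auto simp: S_def u_def intro: gr0I)
      have "i - 1 \<notin> S"
        using Min_le[OF \<open>finite S\<close>, of "i - 1"] \<open>i \<noteq> 0\<close> unfolding i_def[symmetric] by auto
      then have "fst (t (i - 1)) = u" "fst (t i) \<noteq> u"
        using ij \<open>j < n\<close> by (auto simp: S_def)
      then have i: "t (i - 1) = (u, r)"
        using cross[of "i - 1"] \<open>i \<noteq> 0\<close> by auto
      have "Suc j \<notin> S"
        using Max_ge[OF \<open>finite S\<close>, of "Suc j"] unfolding j_def[symmetric] by auto
      moreover have "t n = t 0"
        by (simp add: inj)
      ultimately have "fst (t (Suc j)) = u" "fst (t j) \<noteq> u"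
        using ij \<open>j < n\<close> by (cases "Suc j = n"; auto simp: S_def u_def)+
      then have j: "t (Suc j) = (u, r)"
        using cross[of j] by auto
      \<comment> \<open>Here the start off the root matters: position \<open>n\<close> repeats
        position 0, which is not a root. Hence \<open>i - 1\<close> and \<open>Suc j\<close> are
        different positions within one period, yet carry the same vertex.\<close>
      then have "Suc j \<noteq> n"
        using t(2) \<open>t n = t 0\<close> by auto
      then have "Suc j < n"
        using \<open>j < n\<close> by simp
      moreover have "(i - 1) mod n = Suc j mod n"
        using i j by (simp flip: inj)
      ultimately show False
        using ij by simp
    qed
  qed
qed

lemma undirected_tree_rooted_product:
  assumes "undirected_tree G" "undirected_tree H" "r \<in> pverts H"
  shows "undirected_tree (rooted_product G H r)"
proof -
  let ?P = "rooted_product G H r"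
  note G = undirected_treeD[OF assms(1)] and H = undirected_treeD[OF assms(2)]
  have inner: "((u, x), (u, y)) \<in> (parcs ?P)\<^sup>*" if "(x, y) \<in> (parcs H)\<^sup>*" "u \<in> pverts G" for u x y
    using that
  proof (induction rule: rtrancl_induct)
    case (step y z)
    then have "((u, y), (u, z)) \<in> parcs ?P"
      by (simp add: parcs_rooted_product_iff)
    with step show ?case
      by (meson rtrancl.rtrancl_into_rtrancl)
  qed simp
  have outer: "((u, r), (v, r)) \<in> (parcs ?P)\<^sup>*" if "(u, v) \<in> (parcs G)\<^sup>*" for u v
    using that
  proof (induction rule: rtrancl_induct)
    case (step y z)
    then have "((y, r), (z, r)) \<in> parcs ?P"
      by (simp add: parcs_rooted_product_iff)
    with step show ?case
      by (meson rtrancl.rtrancl_into_rtrancl)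
  qed simp
  have "((u, x), (v, y)) \<in> (parcs ?P)\<^sup>*"
    if "u \<in> pverts G" "v \<in> pverts G" "x \<in> pverts H" "y \<in> pverts H" for u v x y
    using inner[OF H(6)[of x r], of u] outer[OF G(6)[of u v]] inner[OF H(6)[of r y], of v] that assms(3)
    by (meson rtrancl_trans)
  moreover have "sym (parcs ?P)"
    using G(2,3) H(3) unfolding sym_def parcs_rooted_product_iff by auto
  moreover have "irrefl (parcs ?P)"
    using G(4) H(4) unfolding irrefl_def parcs_rooted_product_iff by blast
  moreover have "parcs ?P \<subseteq> pverts ?P \<times> pverts ?P"
    using G(2) H(2) assms(3) by (auto simp: parcs_rooted_product_iff)
  ultimately show ?thesis
    using G(1,5) H(1,5) not_circuit_rooted_product[OF G(7,4) H(7,4)]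
    unfolding undirected_tree_iff by auto
qed

section \<open>Eigenfunctions\<close>

text \<open>Indexing by vertices avoids choosing an ordering. The zero function qualifies, so
  nonvanishing is always demanded separately.\<close>

definition eigenfunction :: "'v pair_pre_digraph \<Rightarrow> real \<Rightarrow> ('v \<Rightarrow> real) \<Rightarrow> bool" where
  "eigenfunction G l f \<longleftrightarrow> (\<forall>v\<in>pverts G. sum f (parcs G `` {v}) = l * f v)"

lemma eigenvector_adjacency_matrix_iff:
  assumes "distinct vs" "set vs = pverts G" "parcs G \<subseteq> pverts G \<times> pverts G"
  shows "eigenvector (adjacency_matrix G vs) (vec (length vs) (\<lambda>i. f (vs ! i))) l \<longleftrightarrow>
    eigenfunction G l f \<and> (\<exists>v\<in>pverts G. f v \<noteq> 0)"
proof -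
  let ?n = "length vs" and ?x = "vec (length vs) (\<lambda>i. f (vs ! i))"
  have entry: "(adjacency_matrix G vs *\<^sub>v ?x) $ i = sum f (parcs G `` {vs ! i})" if "i < ?n" for i
  proof -
    \<comment> \<open>A list of the vertices without repetition turns the sum over column positions
      into a sum over vertices.\<close>
    have bij: "bij_betw ((!) vs) {0..<?n} (pverts G)"
      using bij_betw_nth[OF assms(1)] assms(2) by (simp add: atLeast0LessThan)
    have "(adjacency_matrix G vs *\<^sub>v ?x) $ i =
        (\<Sum>j = 0..<?n. if (vs ! i, vs ! j) \<in> parcs G then f (vs ! j) else 0)"
      using that by (auto simp: adjacency_matrix_def scalar_prod_def intro!: sum.cong)
    also have "\<dots> = (\<Sum>w\<in>pverts G. if (vs ! i, w) \<in> parcs G then f w else 0)"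
      by (rule sum.reindex_bij_betw[OF bij])
    also have "\<dots> = sum f (parcs G `` {vs ! i})"
      using assms(2,3) finite_set[of vs] by (intro sum.mono_neutral_cong_right) auto
    finally show ?thesis .
  qed
  have "adjacency_matrix G vs *\<^sub>v ?x = l \<cdot>\<^sub>v ?x \<longleftrightarrow>
      (\<forall>i<?n. sum f (parcs G `` {vs ! i}) = l * f (vs ! i))"
    using entry by (auto simp: vec_eq_iff) (simp_all add: adjacency_matrix_def)
  moreover have "\<dots> \<longleftrightarrow> eigenfunction G l f"
    unfolding eigenfunction_def assms(2)[symmetric] by (simp add: all_set_conv_all_nth)
  moreover have "?x \<noteq> 0\<^sub>v ?n \<longleftrightarrow> (\<exists>v\<in>pverts G. f v \<noteq> 0)"
    unfolding assms(2)[symmetric] by (simp add: vec_eq_iff) (metis in_set_conv_nth)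
  ultimately show ?thesis
    by (simp add: eigenvector_def adjacency_matrix_def conj_commute)
qed

text \<open>Distinct entries give each listed vertex a unique position, so every vector tabulates
  some function on vertices. This transfers existence of eigenvectors to eigenfunctions.\<close>

lemma ex_vec_conv_ex_fun:
  assumes "distinct vs"
  shows "(\<exists>x\<in>carrier_vec (length vs). P x) \<longleftrightarrow> (\<exists>f. P (vec (length vs) (\<lambda>i. f (vs ! i))))"
proof
  assume "\<exists>x\<in>carrier_vec (length vs). P x"
  then obtain x where x: "x \<in> carrier_vec (length vs)" "P x"
    by blast
  define f where "f v = x $ the_inv_into {..<length vs} ((!) vs) v" for v
  have "vec (length vs) (\<lambda>i. f (vs ! i)) = x"
    using x(1) inj_on_nth[OF assms, of "{..<length vs}"]
    by (auto simp: f_def vec_eq_iff the_inv_into_f_f)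
  then show "\<exists>f. P (vec (length vs) (\<lambda>i. f (vs ! i)))"
    using x(2) by metis
qed (use vec_carrier in blast)

lemma totally_minimal_iff_eigenfunction:
  "totally_minimal T \<longleftrightarrow> undirected_tree T \<and>
    (\<forall>l f. eigenfunction T l f \<longrightarrow> (\<exists>v\<in>pverts T. f v \<noteq> 0) \<longrightarrow>
      (\<exists>g. eigenfunction T l g \<and> (\<forall>v\<in>pverts T. g v \<noteq> 0)))"
proof (cases "undirected_tree T")
  case True
  note fin = undirected_treeD(1)[OF True] and sub = undirected_treeD(2)[OF True]
    and ne = undirected_treeD(5)[OF True]
  have *: "(\<forall>l. eigenvalue (adjacency_matrix T vs) l \<longrightarrow>
           (\<exists>x. eigenvector (adjacency_matrix T vs) x l \<and> (\<forall>i < dim_vec x. x $ i \<noteq> 0))) \<longleftrightarrow>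
     (\<forall>l f. eigenfunction T l f \<longrightarrow> (\<exists>v\<in>pverts T. f v \<noteq> 0) \<longrightarrow>
      (\<exists>g. eigenfunction T l g \<and> (\<forall>v\<in>pverts T. g v \<noteq> 0)))"
    if vs: "distinct vs" "set vs = pverts T" for vs
  proof -
    note iff = eigenvector_adjacency_matrix_iff[OF vs sub]
    have nth: "(\<forall>i<length vs. g (vs ! i) \<noteq> 0) \<longleftrightarrow> (\<forall>v\<in>pverts T. g v \<noteq> (0::real))" for g
      unfolding vs(2)[symmetric] by (simp add: all_set_conv_all_nth)
    have carrier: "x \<in> carrier_vec (length vs)" if "eigenvector (adjacency_matrix T vs) x l" for x l
      using that by (simp add: eigenvector_def adjacency_matrix_def)
    have "eigenvalue (adjacency_matrix T vs) l \<longleftrightarrow>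
        (\<exists>f. eigenfunction T l f \<and> (\<exists>v\<in>pverts T. f v \<noteq> 0))" for l
      unfolding eigenvalue_def iff[symmetric]
      using ex_vec_conv_ex_fun[OF vs(1), of "\<lambda>x. eigenvector (adjacency_matrix T vs) x l"] carrier
      by blast
    moreover have "(\<exists>x. eigenvector (adjacency_matrix T vs) x l \<and> (\<forall>i < dim_vec x. x $ i \<noteq> 0)) \<longleftrightarrow>
        (\<exists>g. eigenfunction T l g \<and> (\<forall>v\<in>pverts T. g v \<noteq> 0))" for l
    proof -
      let ?Q = "\<lambda>x. eigenvector (adjacency_matrix T vs) x l \<and> (\<forall>i < dim_vec x. x $ i \<noteq> 0)"
      have "(\<exists>x. ?Q x) \<longleftrightarrow> (\<exists>x\<in>carrier_vec (length vs). ?Q x)"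
        using carrier by blast
      also have "\<dots> \<longleftrightarrow> (\<exists>g. ?Q (vec (length vs) (\<lambda>i. g (vs ! i))))"
        by (rule ex_vec_conv_ex_fun[OF vs(1)])
      also have "\<dots> \<longleftrightarrow> (\<exists>g. (eigenfunction T l g \<and> (\<exists>v\<in>pverts T. g v \<noteq> 0)) \<and>
          (\<forall>i<length vs. g (vs ! i) \<noteq> 0))"
        unfolding iff by simp
      also have "\<dots> \<longleftrightarrow> (\<exists>g. eigenfunction T l g \<and> (\<forall>v\<in>pverts T. g v \<noteq> 0))"
        \<comment> \<open>A tree has a vertex, so a nowhere zero \<open>g\<close> is in particular
          not the zero function.\<close>
        using ne unfolding nth by auto
      finally show ?thesis .
    qed
    ultimately show ?thesis
      by (simp only:) blast
  qed
  \<comment> \<open>Some ordering exists, so the quantification over orderings is not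
    vacuous.\<close>
  obtain vs where "distinct vs" "set vs = pverts T"
    using finite_distinct_list[OF fin] by blast
  with * True show ?thesis
    unfolding totally_minimal_def by blast
qed (simp add: totally_minimal_def)

section \<open>Paths\<close>

lemma sum_path_graph:
  fixes f :: "nat \<Rightarrow> real"
  assumes "i < n"
  shows "sum f (parcs (path_graph n) `` {i}) =
    (if i = 0 then 0 else f (i - 1)) + (if Suc i < n then f (Suc i) else 0)"
proof -
  have "parcs (path_graph n) `` {i} = (if i = 0 then {} else {i - 1}) \<union> (if Suc i < n then {Suc i} else {})"
    using assms by auto
  then show ?thesis
    by (auto simp: sum.union_disjoint)
qed

text \<open>\<open>path_seq l (Suc n)\<close> is the characteristic polynomial of the path on
  \<open>n\<close> vertices at \<open>l\<close>, a Chebyshev polynomial of the second kind at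
  \<open>l / 2\<close>. Index 0 stands for a fictitious vertex before the path, with value
  0.\<close>

fun path_seq :: "real \<Rightarrow> nat \<Rightarrow> real" where
  "path_seq l 0 = 0"
| "path_seq l (Suc 0) = 1"
| "path_seq l (Suc (Suc j)) = l * path_seq l (Suc j) - path_seq l j"

text \<open>By the recurrence, two consecutive zeros would propagate down to
  \<open>path_seq l 1 = 1\<close>.\<close>

lemma path_seq_consecutive: "path_seq l k \<noteq> 0 \<or> path_seq l (Suc k) \<noteq> 0"
  by (induction k) auto

text \<open>As functions of \<open>j\<close>, both sides satisfy the same recurrence and agree at 0
  and 1.\<close>

lemma path_seq_add:
  assumes "path_seq l k = 0"
  shows "path_seq l (k + j) = path_seq l (Suc k) * path_seq l j"
  using assms by (induction l j rule: path_seq.induct) (auto simp: algebra_simps)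

lemma path_seq_zero_add_iff:
  assumes "path_seq l k = 0"
  shows "path_seq l (k + j) = 0 \<longleftrightarrow> path_seq l j = 0"
  using path_seq_add[OF assms, of j] path_seq_consecutive[of l k] assms by auto

lemma path_seq_zero_mult_add_iff:
  assumes "path_seq l k = 0"
  shows "path_seq l (q * k + j) = 0 \<longleftrightarrow> path_seq l j = 0"
  using path_seq_zero_add_iff[OF assms] by (induction q) (auto simp: add.assoc)

lemma path_seq_prime_nonzero:
  assumes "prime p" "path_seq l p = 0" "0 < j" "j < p"
  shows "path_seq l j \<noteq> 0"
proof
  assume j: "path_seq l j = 0"
  define d where "d = (LEAST d. 0 < d \<and> path_seq l d = 0)"
  have d: "0 < d" "path_seq l d = 0" and "d \<le> j"
    using LeastI[of "\<lambda>d. 0 < d \<and> path_seq l d = 0" j] Least_le[of "\<lambda>d. 0 < d \<and> path_seq l d = 0" j]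
      assms(3) j by (auto simp: d_def)
  \<comment> \<open>Removing multiples of \<open>d\<close> from \<open>p\<close> preserves being a
    zero and leaves an index below the least positive zero.\<close>
  have "path_seq l (p mod d) = 0"
    using path_seq_zero_mult_add_iff[OF d(2), of "p div d" "p mod d"] assms(2) by simp
  moreover have "p mod d < d"
    using d(1) by simp
  ultimately have "p mod d = 0"
    using not_less_Least[of "p mod d" "\<lambda>d. 0 < d \<and> path_seq l d = 0"] by (auto simp: d_def)
  then have "d dvd p"
    by auto
  \<comment> \<open>The other divisor \<open>p\<close> is excluded by
    \<open>d \<le> j < p\<close>.\<close>
  then have "d = 1"
    using assms(1,4) \<open>d \<le> j\<close> by (auto simp: prime_nat_iff)
  then show False
    using d(2) by simp
qed

text \<open>The equations at all vertices but the last determine \<open>f\<close> from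
  \<open>f 0\<close>. The last one has no right neighbour and becomes the boundary
  condition.\<close>

lemma eigenfunction_path_graph:
  assumes f: "eigenfunction (path_graph n) l f"
  shows "i < n \<Longrightarrow> f i = f 0 * path_seq l (Suc i)"
    and "n > 0 \<Longrightarrow> f 0 * path_seq l (Suc n) = 0"
proof -
  have eq: "(if i = 0 then 0 else f (i - 1)) + (if Suc i < n then f (Suc i) else 0) = l * f i" if "i < n" for i
    using f that by (simp add: eigenfunction_def flip: sum_path_graph)
  show val: "f i = f 0 * path_seq l (Suc i)" if "i < n" for i
    using that
  proof (induction i rule: less_induct)
    case (less i)
    consider "i = 0" | "i = 1" | j where "i = Suc (Suc j)"
      by (metis One_nat_def nat.exhaust)
    then show ?case
    proof cases
      case 2
      then show ?thesis
        using eq[of 0] less.prems by simp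
    next
      case 3
      then show ?thesis
        using eq[of "Suc j"] less.IH[of j] less.IH[of "Suc j"] less.prems by (simp add: algebra_simps)
    qed simp
  qed
  \<comment> \<open>For \<open>n = 1\<close> the last vertex has no left neighbour either, so this
    case is separate.\<close>
  show "f 0 * path_seq l (Suc n) = 0" if "n > 0"
  proof (cases "n = 1")
    case True
    then show ?thesis
      using eq[of 0] by auto
  next
    case False
    with that have "n = Suc (Suc (n - 2))"
      by linarith
    then obtain j where "n = Suc (Suc j)"
      by blast
    then show ?thesis
      using eq[of "Suc j"] val[of j] val[of "Suc j"] by (simp add: algebra_simps)
  qed
qed

lemma eigenfunction_path_seq:
  assumes "path_seq l (Suc n) = 0"
  shows "eigenfunction (path_graph n) l (\<lambda>i. path_seq l (Suc i))"
  unfolding eigenfunction_def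
proof
  fix i assume "i \<in> pverts (path_graph n)"
  then have "i < n"
    by simp
  show "(\<Sum>i\<in>parcs (path_graph n) `` {i}. path_seq l (Suc i)) = l * path_seq l (Suc i)"
  \<comment> \<open>At the last vertex the assumed zero at \<open>Suc n\<close> makes up for the
    missing right neighbour.\<close>
  proof (cases "Suc i = n")
    case True
    then have "l * path_seq l (Suc i) = path_seq l i"
      using assms by auto
    then show ?thesis
      using True unfolding sum_path_graph[OF \<open>i < n\<close>] by (cases i) auto
  next
    case False
    then show ?thesis
      using \<open>i < n\<close> unfolding sum_path_graph[OF \<open>i < n\<close>] by (cases i) auto
  qed
qed

lemma totally_minimal_path_graph:
  assumes "prime p"
  shows "totally_minimal (path_graph (p - 1))"
  unfolding totally_minimal_iff_eigenfunction
proof (intro conjI allI impI)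
  have p: "p > 1"
    using assms by (rule prime_gt_1_nat)
  then show "undirected_tree (path_graph (p - 1))"
    by (simp add: undirected_tree_path_graph)
  fix l f
  assume f: "eigenfunction (path_graph (p - 1)) l f" and nz: "\<exists>v\<in>pverts (path_graph (p - 1)). f v \<noteq> 0"
  then have "f 0 \<noteq> 0"
    using eigenfunction_path_graph(1)[OF f] by (metis lessThan_iff mult_eq_0_iff pverts_path_graph)
  then have zero: "path_seq l p = 0"
    using eigenfunction_path_graph(2)[OF f] p by simp
  then show "\<exists>g. eigenfunction (path_graph (p - 1)) l g \<and> (\<forall>v\<in>pverts (path_graph (p - 1)). g v \<noteq> 0)"
    \<comment> \<open>Vertex \<open>i < p - 1\<close> carries the term of index
      \<open>Suc i\<close>, which lies strictly between 0 and \<open>p\<close>.\<close>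
    using p path_seq_prime_nonzero[OF assms zero]
    by (intro exI[of _ "\<lambda>i. path_seq l (Suc i)"] conjI eigenfunction_path_seq) auto
qed

section \<open>Rooted products\<close>

text \<open>The root is left out because in a rooted product its equation also receives the
  neighbours from the other factor.\<close>

definition off_root :: "'v pair_pre_digraph \<Rightarrow> 'v \<Rightarrow> real \<Rightarrow> ('v \<Rightarrow> real) \<Rightarrow> bool" where
  "off_root H r l f \<longleftrightarrow> (\<forall>x\<in>pverts H - {r}. sum f (parcs H `` {x}) = l * f x)"

lemma eigenfunction_rooted_product_iff:
  assumes G: "undirected_tree G" and H: "undirected_tree H" and r: "r \<in> pverts H"
  shows "eigenfunction (rooted_product G H r) l f \<longleftrightarrow>
    (\<forall>u\<in>pverts G. off_root H r l (\<lambda>x. f (u, x)) \<and>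
      (\<Sum>v\<in>parcs G `` {u}. f (v, r)) + (\<Sum>y\<in>parcs H `` {r}. f (u, y)) = l * f (u, r))"
proof -
  let ?P = "rooted_product G H r"
  note G' = undirected_tree_neighbours[OF G] and H' = undirected_tree_neighbours[OF H]
  have inner: "sum f (parcs ?P `` {(u, x)}) = (\<Sum>y\<in>parcs H `` {x}. f (u, y))"
    if "u \<in> pverts G" "x \<noteq> r" for u x
  proof -
    have "parcs ?P `` {(u, x)} = Pair u ` (parcs H `` {x})"
      using that by (auto simp: parcs_rooted_product_iff)
    then show ?thesis
      by (simp add: sum.reindex inj_on_def)
  qed
  have root: "sum f (parcs ?P `` {(u, r)}) =
      (\<Sum>v\<in>parcs G `` {u}. f (v, r)) + (\<Sum>y\<in>parcs H `` {r}. f (u, y))" if "u \<in> pverts G" for u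
  proof -
    have "parcs ?P `` {(u, r)} = (\<lambda>v. (v, r)) ` (parcs G `` {u}) \<union> Pair u ` (parcs H `` {r})"
      using that by (auto simp: parcs_rooted_product_iff)
    moreover have "(\<lambda>v. (v, r)) ` (parcs G `` {u}) \<inter> Pair u ` (parcs H `` {r}) = {}"
      \<comment> \<open>A common element would be \<open>(u, r)\<close>, making \<open>u\<close> its
        own neighbour.\<close>
      using G'(2)[of u] by auto
    ultimately show ?thesis
      using G'(1)[of u] H'(1)[of r] by (simp add: sum.union_disjoint sum.reindex inj_on_def)
  qed
  have "eigenfunction ?P l f \<longleftrightarrow>
      (\<forall>u\<in>pverts G. (\<forall>x\<in>pverts H - {r}. sum f (parcs ?P `` {(u, x)}) = l * f (u, x)) \<and>
        sum f (parcs ?P `` {(u, r)}) = l * f (u, r))"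
    unfolding eigenfunction_def pverts_rooted_product using r by blast
  also have "\<dots> \<longleftrightarrow> (\<forall>u\<in>pverts G. off_root H r l (\<lambda>x. f (u, x)) \<and>
      (\<Sum>v\<in>parcs G `` {u}. f (v, r)) + (\<Sum>y\<in>parcs H `` {r}. f (u, y)) = l * f (u, r))"
    unfolding off_root_def
    by (intro ball_cong refl arg_cong2[where f = "(\<and>)"]) (simp_all add: inner root)
  finally show ?thesis .
qed

text \<open>
  In the first alternative the eigenvalue equation at the root of each copy reads \<open>A f = (l - c) f\<close>
  with \<open>c = sum h (parcs H `` {r})\<close>; in the second one \<open>l\<close> is not an eigenvalue of the product.
\<close>

lemma totally_minimal_rooted_product:
  assumes T: "totally_minimal T" and H: "undirected_tree H" and r: "r \<in> pverts H"
    and local: "\<And>l.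
      (\<exists>h. off_root H r l h \<and> (\<forall>x\<in>pverts H. h x \<noteq> 0) \<and> h r = 1 \<and>
        (\<forall>g. off_root H r l g \<longrightarrow> (\<forall>x\<in>pverts H. g x = g r * h x))) \<or>
      (\<forall>g. off_root H r l g \<longrightarrow>
        g r = 0 \<and> (sum g (parcs H `` {r}) = 0 \<longrightarrow> (\<forall>x\<in>pverts H. g x = 0)))"
  shows "totally_minimal (rooted_product T H r)"
proof -
  let ?P = "rooted_product T H r"
  have tree: "undirected_tree T"
    using T by (simp add: totally_minimal_def)
  note nbr = undirected_tree_neighbours(3)[OF tree, THEN subsetD]
    and nbrH = undirected_tree_neighbours(3)[OF H, THEN subsetD]
  note iff = eigenfunction_rooted_product_iff[OF tree H r]
  have "\<exists>g. eigenfunction ?P l g \<and> (\<forall>v\<in>pverts ?P. g v \<noteq> 0)"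
    if f: "eigenfunction ?P l f" and nz: "\<exists>v\<in>pverts ?P. f v \<noteq> 0" for l f
    using local[of l]
  proof (elim disjE exE conjE)
    fix h
    assume h: "off_root H r l h" "\<forall>x\<in>pverts H. h x \<noteq> 0" "h r = 1"
      and uniq: "\<forall>g. off_root H r l g \<longrightarrow> (\<forall>x\<in>pverts H. g x = g r * h x)"
    define c where "c = sum h (parcs H `` {r})"
    have fh: "f (u, x) = f (u, r) * h x" if "u \<in> pverts T" "x \<in> pverts H" for u x
      using f that uniq[rule_format, of "\<lambda>x. f (u, x)" x] by (simp add: iff)
    have "(\<Sum>v\<in>parcs T `` {u}. f (v, r)) = (l - c) * f (u, r)" if "u \<in> pverts T" for u
    proof -
      have "(\<Sum>y\<in>parcs H `` {r}. f (u, y)) = f (u, r) * c"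
        unfolding c_def sum_distrib_left using that fh nbrH by (intro sum.cong) auto
      then show ?thesis
        using f[unfolded iff, rule_format, OF that] by (simp add: algebra_simps)
    qed
    then have "eigenfunction T (l - c) (\<lambda>u. f (u, r))"
      by (simp add: eigenfunction_def)
    moreover have "\<exists>u\<in>pverts T. f (u, r) \<noteq> 0"
      \<comment> \<open>If \<open>f\<close> vanished at all roots, \<open>fh\<close> would make it
        vanish everywhere.\<close>
      using nz fh by fastforce
    ultimately obtain g where g: "eigenfunction T (l - c) g" "\<forall>u\<in>pverts T. g u \<noteq> 0"
      using T unfolding totally_minimal_iff_eigenfunction by meson
    \<comment> \<open>A nowhere zero eigenfunction of \<open>T\<close> for \<open>l - c\<close> is
      spread over each copy in the proportions given by \<open>h\<close>.\<close>
    define F where "F = (\<lambda>(u, x). g u * h x)"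
    have "off_root H r l (\<lambda>x. F (u, x))" for u
      using h(1) by (simp add: F_def off_root_def flip: sum_distrib_left)
    moreover have "(\<Sum>v\<in>parcs T `` {u}. F (v, r)) + (\<Sum>y\<in>parcs H `` {r}. F (u, y)) = l * F (u, r)"
      if "u \<in> pverts T" for u
      using g(1) h(3) that
      by (simp add: F_def eigenfunction_def algebra_simps c_def flip: sum_distrib_left)
    ultimately have "eigenfunction ?P l F"
      by (simp add: iff)
    moreover have "\<forall>v\<in>pverts ?P. F v \<noteq> 0"
      using g(2) h(2) by (auto simp: F_def)
    ultimately show ?thesis
      by blast
  next
    assume bad: "\<forall>g. off_root H r l g \<longrightarrow>
        g r = 0 \<and> (sum g (parcs H `` {r}) = 0 \<longrightarrow> (\<forall>x\<in>pverts H. g x = 0))"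
    have zero: "f (u, r) = 0" if "u \<in> pverts T" for u
      using f that bad[rule_format, of "\<lambda>x. f (u, x)"] by (simp add: iff)
    \<comment> \<open>With all root values zero, the equation at the root leaves a zero neighbour
      sum inside the copy, as the second alternative requires.\<close>
    have "f (u, x) = 0" if "u \<in> pverts T" "x \<in> pverts H" for u x
    proof -
      have "(\<Sum>v\<in>parcs T `` {u}. f (v, r)) = 0"
        using zero nbr by (intro sum.neutral) auto
      then have "(\<Sum>y\<in>parcs H `` {r}. f (u, y)) = 0"
        using f[unfolded iff, rule_format, OF that(1)] zero[OF that(1)] by simp
      then show ?thesis
        using f that bad[rule_format, of "\<lambda>x. f (u, x)"] by (simp add: iff)
    qed
    then show ?thesis
      using nz by auto
  qed
  then show ?thesis
    using undirected_tree_rooted_product[OF tree H r] unfolding totally_minimal_iff_eigenfunction by blast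
qed

section \<open>Attaching copies of P_2 and P_4\<close>

lemma totally_minimal_rooted_product_P2:
  assumes "totally_minimal T" "r \<in> pverts (path_graph 2)"
  shows "totally_minimal (rooted_product T (path_graph 2) r)"
proof (rule totally_minimal_rooted_product[OF assms(1) _ assms(2)], goal_cases)
  case (2 l)
  have r: "r = 0 \<or> r = 1"
    using assms(2) by auto
  have vert: "pverts (path_graph 2) - {r} = {1 - r}"
    using r by auto
  have sum: "sum g (parcs (path_graph 2) `` {0}) = g (Suc 0)"
    "sum g (parcs (path_graph 2) `` {Suc 0}) = g 0" for g :: "nat \<Rightarrow> real"
    by (simp_all add: sum_path_graph)
  have off: "off_root (path_graph 2) r l g \<longleftrightarrow> g r = l * g (1 - r)" for g
    using r unfolding off_root_def vert by (auto simp: sum cong del: sum.cong_simp)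
  have root: "sum g (parcs (path_graph 2) `` {r}) = g (1 - r)" for g :: "nat \<Rightarrow> real"
    using r by (auto simp: sum cong del: sum.cong_simp)
  have all: "(\<forall>x\<in>pverts (path_graph 2). P x) \<longleftrightarrow> P r \<and> P (1 - r)" for P
    using r by (auto simp: lessThan_nat_numeral lessThan_Suc)
  show ?case
  \<comment> \<open>The equation at the leaf \<open>1 - r\<close> is
    \<open>g r = l * g (1 - r)\<close>. For \<open>l = 0\<close> it kills the root value, and the
    neighbour sum at the root is the leaf value; otherwise the leaf value is
    \<open>g r / l\<close>.\<close>
  proof (cases "l = 0")
    case True
    then show ?thesis
      unfolding off root all by simp
  next
    case False
    define h where "h x = (if x = r then 1 else 1 / l)" for x
    have "1 - r \<noteq> r"
      using r by auto
    then show ?thesis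
      unfolding off root all using False
      by (intro disjI1 exI[of _ h]) (auto simp: h_def)
  qed
qed (simp add: undirected_tree_path_graph)

lemma out_degree_P4_eq_2_iff:
  assumes "r \<in> pverts (path_graph 4)"
  shows "out_degree (with_proj (path_graph 4)) r = 2 \<longleftrightarrow> r = 1 \<or> r = 2"
proof -
  have "out_arcs (with_proj (path_graph 4)) r = Pair r ` (parcs (path_graph 4) `` {r})"
    by (auto simp: out_arcs_def)
  then have "out_degree (with_proj (path_graph 4)) r = card (parcs (path_graph 4) `` {r})"
    by (simp add: out_degree_def card_image inj_on_def)
  moreover have "r \<in> {0, 1, 2, 3}"
    using assms by auto
  moreover have "parcs (path_graph 4) `` {0} = {1}" "parcs (path_graph 4) `` {1} = {0, 2}"
    "parcs (path_graph 4) `` {2} = {1, 3}" "parcs (path_graph 4) `` {3} = {2}"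
    by auto
  ultimately show ?thesis
    by auto
qed

text \<open>
  With root \<open>r\<close>, the vertices of \<open>P\<^sub>4\<close> are the leaf \<open>a\<close> next to \<open>r\<close>, the other inner vertex
  \<open>3 - r\<close> and the leaf \<open>3 - a\<close> next to it.
\<close>

lemma totally_minimal_rooted_product_P4:
  assumes "totally_minimal T" "r = 1 \<or> r = 2"
  shows "totally_minimal (rooted_product T (path_graph 4) r)"
proof (rule totally_minimal_rooted_product[OF assms(1)], goal_cases)
  case (3 l)
  define a where "a = (if r = 1 then 0 else 3 :: nat)"
  have distinct: "distinct [r, a, 3 - r, 3 - a]"
    using assms(2) by (auto simp: a_def)
  have vert: "pverts (path_graph 4) - {r} = {a, 3 - r, 3 - a}"
    using assms(2) by (auto simp: a_def)
  have sum: "sum g (parcs (path_graph 4) `` {0}) = g (Suc 0)"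
    "sum g (parcs (path_graph 4) `` {Suc 0}) = g 0 + g 2"
    "sum g (parcs (path_graph 4) `` {2}) = g (Suc 0) + g 3"
    "sum g (parcs (path_graph 4) `` {3}) = g 2" for g :: "nat \<Rightarrow> real"
    by (simp_all add: sum_path_graph numeral_2_eq_2 numeral_3_eq_3)
  have off: "off_root (path_graph 4) r l g \<longleftrightarrow>
      g r = l * g a \<and> g r + g (3 - a) = l * g (3 - r) \<and> g (3 - r) = l * g (3 - a)" for g
    using assms(2) unfolding off_root_def vert by (auto simp: sum a_def cong del: sum.cong_simp)
  have root: "sum g (parcs (path_graph 4) `` {r}) = g a + g (3 - r)" for g :: "nat \<Rightarrow> real"
    using assms(2) by (auto simp: sum a_def cong del: sum.cong_simp)
  have all: "(\<forall>x\<in>pverts (path_graph 4). P x) \<longleftrightarrow> P r \<and> P a \<and> P (3 - r) \<and> P (3 - a)" for P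
    using assms(2) by (auto simp: lessThan_nat_numeral lessThan_Suc a_def)
  \<comment> \<open>Deleting the root of P_4 leaves a single vertex and an edge, with eigenvalues 0
    and 1, -1. Exactly at these \<open>l\<close> the root value does not determine the copy.\<close>
  consider "l = 0" | "l * l = 1" | "l \<noteq> 0" "l * l \<noteq> 1"
    by blast
  then show ?case
  proof cases
    case 1
    then show ?thesis
      unfolding off root all by auto
  next
    case 2
    have "g r = 0 \<and> (g a + g (3 - r) = 0 \<longrightarrow> g a = 0 \<and> g (3 - r) = 0 \<and> g (3 - a) = 0)"
      if "g r = l * g a" "g r + g (3 - a) = l * g (3 - r)" "g (3 - r) = l * g (3 - a)" for g :: "nat \<Rightarrow> real"
    proof -
      have "l * g (3 - r) = (l * l) * g (3 - a)"
        using that(3) by simp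
      then have "g r = 0"
        using that(2) 2 by simp
      moreover have "l \<noteq> 0"
        using 2 by auto
      ultimately show ?thesis
        using that by auto
    qed
    then show ?thesis
      unfolding off root all by blast
  next
    case 3
    \<comment> \<open>The solution of the three equations off the root with root value 1.\<close>
    define h where "h x = (if x = r then 1 else if x = a then 1 / l
        else if x = 3 - r then l / (l * l - 1) else 1 / (l * l - 1))" for x
    have h: "h r = 1" "h a = 1 / l" "h (3 - r) = l / (l * l - 1)" "h (3 - a) = 1 / (l * l - 1)"
      using distinct by (auto simp: h_def)
    have "g a = g r * (1 / l) \<and> g (3 - r) = g r * (l / (l * l - 1)) \<and> g (3 - a) = g r * (1 / (l * l - 1))"
      if "g r = l * g a" "g r + g (3 - a) = l * g (3 - r)" "g (3 - r) = l * g (3 - a)" for g :: "nat \<Rightarrow> real"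
    proof -
      \<comment> \<open>Eliminating \<open>g (3 - r)\<close> from the equations at
        \<open>3 - r\<close> and \<open>3 - a\<close>.\<close>
      have "g r = (l * l - 1) * g (3 - a)"
        using that(2,3) by (simp add: algebra_simps)
      then have "g (3 - a) = g r * (1 / (l * l - 1))"
        using 3 by simp
      then show ?thesis
        using that(1,3) 3 by simp
    qed
    moreover have "1 + 1 / (l * l - 1) = l * (l / (l * l - 1))"
      using 3 by (simp add: field_simps)
    ultimately show ?thesis
      unfolding off root all using 3
      by (intro disjI1 exI[of _ h]) (auto simp: h)
  qed
qed (use assms(2) in \<open>auto simp: undirected_tree_path_graph\<close>)

theorem theorem4p19:
  fixes T :: "'a pair_pre_digraph"
  assumes "totally_minimal T"
  shows "(\<forall>p::nat. prime p \<longrightarrow> totally_minimal (path_graph (p - 1))) \<and>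
    (\<forall>r \<in> pverts (path_graph 2). totally_minimal (rooted_product T (path_graph 2) r)) \<and>
    (\<forall>r \<in> pverts (path_graph 4). out_degree (with_proj (path_graph 4)) r = 2 \<longrightarrow>
       totally_minimal (rooted_product T (path_graph 4) r))"
  using totally_minimal_path_graph totally_minimal_rooted_product_P2[OF assms]
    totally_minimal_rooted_product_P4[OF assms] out_degree_P4_eq_2_iff
  by blast

end
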